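(* Let $I\subseteq\mathbb{R}$ be an interval, $n\in\mathbb{N}$, $\mathbf{f}=(f_1,\dots,f_n)\in\mathcal{S}^{Lip}(I)^n$, and $a\in I^n$. Consider the mapping $\mathbf{A}_{\mathbf{f}}=(\mathscr{A}_{f_1},\dots,\mathscr{A}_{f_n})\colon I^n\to I^n$. Then either the iteration process of $\mathbf{A}_{\mathbf{f}}$ is degenerated, or the sequence $\big(\delta(\mathbf{A}_{\mathbf{f}}^k(a))\big)_{k=1}^\infty$ tends to zero quadratically.
   Context: For a vector $v\in\mathbb{R}^n$, $\delta(v)=\max(v)-\min(v)$ is the spread. For a continuous strictly monotone $f\colon I\to\mathbb{R}$ and $a\in I^n$, the quasi-arithmetic mean is $\mathscr{A}_f(a)=f^{-1}\big(\frac1n\sum_{i=1}^n f(a_i)\big)$. For $\mathbf{f}=(f_1,\dots,f_n)$, $\mathbf{A}_{\mathbf{f}}(a)=(\mathscr{A}_{f_1}(a),\dots,\mathscr{A}_{f_n}(a))$, and $\mathbf{A}_{\mathbf{f}}^k$ is its $k$-th iterate. $\mathcal{S}^{Lip}(I)$ is the set of $f\in\mathcal{C}^2(I)$ such that $f'\neq0$ everywhere on $I$, $f''$ has bounded variation on every compact subinterval of $I$, and $f''$ is locally Lipschitz. The iteration process of $\mathbf{A}_{\mathbf{f}}$ is called degenerated if there exist a nonconstant vector $v\in I^n$ and $k_0\in\mathbb{N}$ such that $\mathbf{A}_{\mathbf{f}}^{k_0}(v)$ is a constant vector (all entries equal). A sequence $(d_k)$ of nonnegative reals tends to zero quadratically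 if $d_k\to0$ and there is a constant $M$ (independent of $k$) such that $d_{k+1}\le M d_k^2$ for all $k$. *)

theory Defs
  imports "HOL-Analysis.Analysis"
begin

definition spread :: "real^'n \<Rightarrow> real" where
  "spread v = Max (range (\<lambda>i. v $ i)) - Min (range (\<lambda>i. v $ i))"

definition cube :: "real set \<Rightarrow> (real^'n) set" where
  "cube I = {v. \<forall>i. v $ i \<in> I}"

definition constant_vec :: "real^'n \<Rightarrow> bool" where
  "constant_vec v \<longleftrightarrow> (\<exists>c. \<forall>i. v $ i = c)"

text \<open>The inverse is that of the restriction of the generator to \<open>I\<close>; values of the generator
  outside \<open>I\<close> are irrelevant.\<close>
definition quasi_arith_mean :: "real set \<Rightarrow> (real \<Rightarrow> real) \<Rightarrow> real^'n \<Rightarrow> real" where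
  "quasi_arith_mean I f a = the_inv_into I f ((\<Sum>i\<in>UNIV. f (a $ i)) / real CARD('n))"

definition quasi_arith_map :: "real set \<Rightarrow> ('n \<Rightarrow> real \<Rightarrow> real) \<Rightarrow> real^'n \<Rightarrow> real^'n" where
  "quasi_arith_map I f a = (\<chi> i. quasi_arith_mean I (f i) a)"

definition bounded_variation_on :: "real \<Rightarrow> real \<Rightarrow> (real \<Rightarrow> real) \<Rightarrow> bool" where
  "bounded_variation_on a b g \<longleftrightarrow>
     (\<exists>V. \<forall>m p. mono_on {..m} p \<and> p 0 = a \<and> p m = b \<longrightarrow>
        (\<Sum>k<m. \<bar>g (p (Suc k)) - g (p k)\<bar>) \<le> V)"

text \<open>The one-function case of \<open>local_lipschitz\<close>; neighbourhoods are relative to \<open>S\<close>, so end points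
  belonging to \<open>S\<close> are included.\<close>
definition locally_lipschitz_on :: "real set \<Rightarrow> (real \<Rightarrow> real) \<Rightarrow> bool" where
  "locally_lipschitz_on S g \<longleftrightarrow>
     (\<forall>x\<in>S. \<exists>u>0. \<exists>L. L-lipschitz_on (cball x u \<inter> S) g)"

text \<open>Derivatives are taken within \<open>I\<close>, i.e. they are one-sided at end points belonging to \<open>I\<close>.
  On a nondegenerate interval \<open>f'\<close> and \<open>f''\<close> are uniquely determined on \<open>I\<close>.\<close>
definition S_Lip :: "real set \<Rightarrow> (real \<Rightarrow> real) set" where
  "S_Lip I = {f. \<exists>f' f''.
      (\<forall>x\<in>I. (f has_real_derivative f' x) (at x within I)) \<and>
      (\<forall>x\<in>I. (f' has_real_derivative f'' x) (at x within I)) \<and>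
      continuous_on I f'' \<and>
      (\<forall>x\<in>I. f' x \<noteq> 0) \<and>
      (\<forall>a b. a \<le> b \<and> {a..b} \<subseteq> I \<longrightarrow> bounded_variation_on a b f'') \<and>
      locally_lipschitz_on I f''}"

definition degenerated :: "real set \<Rightarrow> (real^'n \<Rightarrow> real^'n) \<Rightarrow> bool" where
  "degenerated I F \<longleftrightarrow>
     (\<exists>v\<in>cube I. \<not> constant_vec v \<and> (\<exists>k\<^sub>0. constant_vec ((F ^^ k\<^sub>0) v)))"

definition tends_to_zero_quadratically :: "(nat \<Rightarrow> real) \<Rightarrow> bool" where
  "tends_to_zero_quadratically d \<longleftrightarrow>
     (\<forall>k. 0 \<le> d k) \<and> d \<longlonglongrightarrow> 0 \<and> (\<exists>M. \<forall>k. d (Suc k) \<le> M * (d k)\<^sup>2)"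

end

theory Submission
  imports Defs
begin

text \<open>
  Along the iteration every vector stays in \<open>J\<^sup>n\<close>, where \<open>J\<close> is the compact interval spanned by the
  entries of \<open>a\<close>, because each mean lies between the extreme entries. On \<open>J\<close> the derivatives of
  the generators are bounded, bounded away from zero and Lipschitz; all constants below come from
  these bounds, so they are uniform in \<open>k\<close>. Two estimates for one mean \<open>A = \<A>\<^sub>f(v)\<close> suffice.

  \<^item> Expanding \<open>f(v\<^sub>i)\<close> to first order around \<open>A\<close> and averaging, the terms \<open>f(A)\<close> cancel by the
    definition of \<open>A\<close>. What is left says that \<open>f'(A)\<close> times the difference between \<open>A\<close> and the
    arithmetic mean is at most a multiple of \<open>\<delta>(v)\<^sup>2\<close> (\<open>quasi_arith_near_arithmetic\<close>). All
    components of \<open>\<A>\<^sub>f(v)\<close> being this close to the same number, they are this close to each other.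
  \<^item> The smallest entry carries weight \<open>1/n\<close> in the average of the \<open>f(v\<^sub>i)\<close>, so \<open>A\<close> stays below the
    largest entry by at least a fixed fraction of \<open>\<delta>(v)\<close> (\<open>quasi_arith_below_max\<close>). Hence the spread
    decreases at least geometrically, and in particular it tends to zero.

  Thus the second alternative of the theorem always holds.
\<close>

section \<open>Spread of a vector\<close>

lemma entries_extrema:
  fixes v :: "real^'n"
  obtains i j where "\<And>k. v $ i \<le> v $ k" "\<And>k. v $ k \<le> v $ j" "spread v = v $ j - v $ i"
proof -
  let ?R = "range (\<lambda>i. v $ i)"
  have "Min ?R \<in> ?R" "Max ?R \<in> ?R"
    by (auto intro!: Min_in Max_in)
  then obtain i j where ij: "Min ?R = v $ i" "Max ?R = v $ j"
    by (metis imageE)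
  moreover have "Min ?R \<le> v $ k" "v $ k \<le> Max ?R" for k
    by auto
  ultimately show ?thesis
    using that by (auto simp: spread_def)
qed

lemma spread_nonneg: "0 \<le> spread v"
  by (metis entries_extrema diff_ge_0_iff_ge)

lemma spread_leI:
  assumes "\<And>i j. v $ i - v $ j \<le> B"
  shows "spread v \<le> B"
  by (metis assms entries_extrema)

section \<open>Generators on a compact interval\<close>

lemma S_Lip_bounds_on_compact:
  assumes f: "f \<in> S_Lip I" and sub: "{p..q} \<subseteq> I"
  obtains f' m M L where "0 < m" "0 \<le> L"
    and "\<And>x. x \<in> {p..q} \<Longrightarrow> (f has_real_derivative f' x) (at x within {p..q})"
    and "\<And>x. x \<in> {p..q} \<Longrightarrow> m \<le> \<bar>f' x\<bar> \<and> \<bar>f' x\<bar> \<le> M"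
    and "\<And>x y. x \<in> {p..q} \<Longrightarrow> y \<in> {p..q} \<Longrightarrow> \<bar>f' x - f' y\<bar> \<le> L * \<bar>x - y\<bar>"
proof (cases "{p..q} = {}")
  case True
  show ?thesis
    by (rule that[of 1 0 "\<lambda>_. 0" 0]) (use True in auto)
next
  case False
  obtain f' f'' where D: "\<And>x. x \<in> I \<Longrightarrow> (f has_real_derivative f' x) (at x within I)"
      "\<And>x. x \<in> I \<Longrightarrow> (f' has_real_derivative f'' x) (at x within I)"
    and c: "continuous_on I f''" and nz: "\<And>x. x \<in> I \<Longrightarrow> f' x \<noteq> 0"
    using f unfolding S_Lip_def by blast
  have D1: "(f has_real_derivative f' x) (at x within {p..q})"
   and D2: "(f' has_real_derivative f'' x) (at x within {p..q})" if "x \<in> {p..q}" for x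
    using has_field_derivative_subset[OF D(1) sub] has_field_derivative_subset[OF D(2) sub] that sub by auto
  have cont: "continuous_on {p..q} (\<lambda>x. \<bar>f' x\<bar>)" "continuous_on {p..q} (\<lambda>x. \<bar>f'' x\<bar>)"
    using D2 DERIV_continuous_on continuous_on_rabs apply blast
    using c sub continuous_on_subset continuous_on_rabs by blast
  obtain z where z: "z \<in> {p..q}" "\<And>x. x \<in> {p..q} \<Longrightarrow> \<bar>f' z\<bar> \<le> \<bar>f' x\<bar>"
    using continuous_attains_inf[OF compact_Icc False cont(1)] by auto
  obtain w where w: "\<And>x. x \<in> {p..q} \<Longrightarrow> \<bar>f' x\<bar> \<le> \<bar>f' w\<bar>"
    using continuous_attains_sup[OF compact_Icc False cont(1)] by blast
  obtain u where u: "\<And>x. x \<in> {p..q} \<Longrightarrow> \<bar>f'' x\<bar> \<le> \<bar>f'' u\<bar>"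
    using continuous_attains_sup[OF compact_Icc False cont(2)] by blast
  have "\<bar>f' x - f' y\<bar> \<le> \<bar>f'' u\<bar> * \<bar>x - y\<bar>" if "x \<in> {p..q}" "y \<in> {p..q}" for x y
    using field_differentiable_bound[of "{p..q}" f' f'' "\<bar>f'' u\<bar>" x y] D2 u that by auto
  moreover have "0 < \<bar>f' z\<bar>"
    using z nz sub by auto
  ultimately show ?thesis
    by (intro that[of "\<bar>f' z\<bar>" "\<bar>f'' u\<bar>" f' "\<bar>f' w\<bar>"]) (use D1 z w in auto)
qed

lemma expanding_if_deriv_bounded_below:
  fixes f :: "real \<Rightarrow> real"
  assumes D: "\<And>x. x \<in> {p..q} \<Longrightarrow> (f has_real_derivative f' x) (at x within {p..q})"
    and m: "\<And>x. x \<in> {p..q} \<Longrightarrow> m \<le> \<bar>f' x\<bar>"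
    and xy: "x \<in> {p..q}" "y \<in> {p..q}" "x \<le> y"
  shows "m * (y - x) \<le> \<bar>f y - f x\<bar>"
proof (cases "x = y")
  case False
  then have "x < y" using xy by simp
  moreover have "(f has_derivative (*) (f' z)) (at z within {x..y})" if "x \<le> z" "z \<le> y" for z
    using has_field_derivative_subset[OF D[of z], of "{x..y}"] that xy
    by (auto simp: has_field_derivative_def)
  ultimately obtain z where z: "z \<in> {x<..<y}" "f y - f x = f' z * (y - x)"
    using mvt_simple[of x y f "\<lambda>z. (*) (f' z)"] by auto
  then have "m \<le> \<bar>f' z\<bar>" using xy by (intro m) auto
  then show ?thesis
    using z by (simp add: abs_mult mult_right_mono)
qed auto

lemma S_Lip_inj_on:
  assumes I: "is_interval I" and f: "f \<in> S_Lip I"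
  shows "inj_on f I"
proof (rule linorder_inj_onI')
  fix x y assume xy: "x \<in> I" "y \<in> I" "x < y"
  then have sub: "{x..y} \<subseteq> I"
    using I by (meson atLeastAtMost_iff mem_is_interval_1_I subsetI)
  obtain f' m M L where "0 < m"
    and "\<And>z. z \<in> {x..y} \<Longrightarrow> (f has_real_derivative f' z) (at z within {x..y})"
    and "\<And>z. z \<in> {x..y} \<Longrightarrow> m \<le> \<bar>f' z\<bar> \<and> \<bar>f' z\<bar> \<le> M"
    using S_Lip_bounds_on_compact[OF f sub] by metis
  then have "m * (y - x) \<le> \<bar>f y - f x\<bar>" "0 < m * (y - x)"
    using expanding_if_deriv_bounded_below[of x y f f' m x y] xy by auto
  then show "f x \<noteq> f y" by auto
qed

lemma S_Lip_continuous_on: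
  assumes "f \<in> S_Lip I"
  shows "continuous_on I f"
  using assms unfolding S_Lip_def by (auto intro: DERIV_continuous_on)

section \<open>A single quasi-arithmetic mean\<close>

text \<open>The average of the \<open>f(v\<^sub>i)\<close> is a convex combination of points of \<open>f({x..y})\<close>, which is an
  interval and therefore convex. So the inverse is applied to a value that \<open>f\<close> attains
  between the bounds \<open>x\<close> and \<open>y\<close> of the entries.\<close>

lemma quasi_arith_mean_between:
  fixes v :: "real^'n::finite"
  assumes I: "is_interval I" and f: "f \<in> S_Lip I"
    and sub: "{x..y} \<subseteq> I" and v: "\<And>i. v $ i \<in> {x..y}"
  shows "quasi_arith_mean I f v \<in> {x..y}"
    and "f (quasi_arith_mean I f v) = (\<Sum>i\<in>UNIV. f (v $ i)) / real CARD('n)"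
proof -
  let ?s = "(\<Sum>i\<in>UNIV. f (v $ i)) / real CARD('n)"
  have "connected (f ` {x..y})"
    using S_Lip_continuous_on[OF f] sub
    by (intro connected_continuous_image) (auto intro: continuous_on_subset)
  then have "convex (f ` {x..y})"
    by (simp add: is_interval_convex_1[symmetric] is_interval_connected_1)
  then have "(\<Sum>i\<in>UNIV. (1 / real CARD('n)) *\<^sub>R f (v $ i)) \<in> f ` {x..y}"
    using v by (intro convex_sum) auto
  then have "?s \<in> f ` {x..y}"
    by (simp add: sum_divide_distrib)
  then obtain A where A: "A \<in> {x..y}" "f A = ?s" by auto
  have "quasi_arith_mean I f v = A"
    unfolding quasi_arith_mean_def
    using A sub S_Lip_inj_on[OF I f] by (intro the_inv_into_f_eq) auto
  then show "quasi_arith_mean I f v \<in> {x..y}" "f (quasi_arith_mean I f v) = ?s"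
    using A by auto
qed

text \<open>Averaging \<open>f(v\<^sub>i) = f(A) + f'(A) (v\<^sub>i - A) + r\<^sub>i\<close> over \<open>i\<close> gives
  \<open>f'(A) (v\<^sub>1 + \<dots> + v\<^sub>n - n A) = - (r\<^sub>1 + \<dots> + r\<^sub>n)\<close>, and each remainder is at most \<open>L \<delta>(v)\<^sup>2\<close>
  because \<open>f'\<close> is Lipschitz and both \<open>v\<^sub>i\<close> and \<open>A\<close> lie between the extreme entries.\<close>

lemma quasi_arith_near_arithmetic:
  fixes f :: "real \<Rightarrow> real"
  assumes I: "is_interval I" and f: "f \<in> S_Lip I" and sub: "{p..q} \<subseteq> I"
  obtains C where "\<And>v::real^'n::finite. v \<in> cube {p..q} \<Longrightarrow>
    \<bar>quasi_arith_mean I f v - (\<Sum>i\<in>UNIV. v $ i) / real CARD('n)\<bar> \<le> C * (spread v)\<^sup>2"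
proof -
  obtain f' m M L where m: "0 < m" and L: "0 \<le> L"
    and D: "\<And>x. x \<in> {p..q} \<Longrightarrow> (f has_real_derivative f' x) (at x within {p..q})"
    and b: "\<And>x. x \<in> {p..q} \<Longrightarrow> m \<le> \<bar>f' x\<bar> \<and> \<bar>f' x\<bar> \<le> M"
    and lip: "\<And>x y. x \<in> {p..q} \<Longrightarrow> y \<in> {p..q} \<Longrightarrow> \<bar>f' x - f' y\<bar> \<le> L * \<bar>x - y\<bar>"
    using S_Lip_bounds_on_compact[OF f sub] by metis
  show ?thesis
  proof (rule that[of "L / m"])
    fix v :: "real^'n" assume v: "v \<in> cube {p..q}"
    obtain i j where ext: "\<And>k. v $ i \<le> v $ k" "\<And>k. v $ k \<le> v $ j"
      and s: "spread v = v $ j - v $ i"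
      using entries_extrema by blast
    define x y d n where "x = v $ i" and "y = v $ j" and "d = y - x" and "n = real CARD('n)"
    define A where "A = quasi_arith_mean I f v"
    have n: "n > 0" by (simp add: n_def)
    have d: "spread v = d" by (simp add: s d_def x_def y_def)
    have vxy: "v $ k \<in> {x..y}" for k using ext by (simp add: x_def y_def)
    have J: "{x..y} \<subseteq> {p..q}" using v by (auto simp: cube_def x_def y_def intro: order_trans)
    have A: "A \<in> {x..y}" "f A = (\<Sum>i\<in>UNIV. f (v $ i)) / n"
      unfolding A_def n_def by (rule quasi_arith_mean_between[OF I f]; use sub J vxy in blast)+
    define r where "r k = f (v $ k) - f A - f' A * (v $ k - A)" for k
    have r: "\<bar>r k\<bar> \<le> L * d\<^sup>2" for k
    proof -
      \<comment> \<open>the mean value inequality for \<open>f\<close> minus its linear part at \<open>A\<close>\<close>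
      have "\<bar>(f (v $ k) - f' A * v $ k) - (f A - f' A * A)\<bar> \<le> L * d * \<bar>v $ k - A\<bar>"
      proof (rule field_differentiable_bound[of "{x..y}" _ "\<lambda>z. f' z - f' A",
            unfolded real_norm_def])
        fix z assume z: "z \<in> {x..y}"
        have "(f has_real_derivative f' z) (at z within {x..y})"
          using D[of z] z J by (auto intro: has_field_derivative_subset)
        then show "((\<lambda>z. f z - f' A * z) has_real_derivative f' z - f' A) (at z within {x..y})"
          by (auto intro!: derivative_eq_intros)
        have "\<bar>f' z - f' A\<bar> \<le> L * \<bar>z - A\<bar>"
          using z A J by (intro lip) auto
        also have "\<dots> \<le> L * d"
          using z A L by (intro mult_left_mono) (auto simp: d_def)
        finally show "\<bar>f' z - f' A\<bar> \<le> L * d" .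
      qed (use vxy A in auto)
      also have "\<dots> \<le> L * d * d"
        using A vxy[of k] L by (intro mult_left_mono) (auto simp: d_def)
      finally show ?thesis
        by (simp add: r_def algebra_simps power2_eq_square)
    qed
    have "(\<Sum>k\<in>UNIV. r k) = n * f A - n * f A - f' A * ((\<Sum>k\<in>UNIV. v $ k) - n * A)"
      using A(2) n by (simp add: r_def sum_subtractf sum_distrib_left[symmetric] n_def)
    then have "\<bar>f' A\<bar> * \<bar>(\<Sum>k\<in>UNIV. v $ k) - n * A\<bar> = \<bar>\<Sum>k\<in>UNIV. r k\<bar>"
      by (simp add: abs_mult)
    also have "\<dots> \<le> (\<Sum>k\<in>(UNIV::'n set). L * d\<^sup>2)"
      by (intro order.trans[OF sum_abs] sum_mono r)
    finally have "\<bar>f' A\<bar> * \<bar>(\<Sum>k\<in>UNIV. v $ k) - n * A\<bar> \<le> n * (L * d\<^sup>2)"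
      by (simp add: n_def)
    moreover have "m \<le> \<bar>f' A\<bar>" using A J b by blast
    then have "m * \<bar>(\<Sum>k\<in>UNIV. v $ k) - n * A\<bar> \<le> \<bar>f' A\<bar> * \<bar>(\<Sum>k\<in>UNIV. v $ k) - n * A\<bar>"
      by (rule mult_right_mono) simp
    moreover have "\<bar>(\<Sum>k\<in>UNIV. v $ k) - n * A\<bar> = n * \<bar>A - (\<Sum>k\<in>UNIV. v $ k) / n\<bar>"
    proof -
      have "n * (A - (\<Sum>k\<in>UNIV. v $ k) / n) = n * A - (\<Sum>k\<in>UNIV. v $ k)"
        using n by (simp add: field_simps)
      then show ?thesis
        using n by (metis abs_minus_commute abs_mult abs_of_pos)
    qed
    ultimately have "n * (m * \<bar>A - (\<Sum>k\<in>UNIV. v $ k) / n\<bar>) \<le> n * (L * d\<^sup>2)"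
      by (simp add: mult.left_commute)
    then have "m * \<bar>A - (\<Sum>k\<in>UNIV. v $ k) / n\<bar> \<le> L * d\<^sup>2"
      using n by simp
    then show "\<bar>quasi_arith_mean I f v - (\<Sum>i\<in>UNIV. v $ i) / real CARD('n)\<bar>
        \<le> L / m * (spread v)\<^sup>2"
      using m by (simp add: d A_def n_def field_simps)
  qed
qed

text \<open>With \<open>x\<close>, \<open>y\<close> the extreme entries, the differences \<open>f(y) - f(v\<^sub>k)\<close> all have the sign of
  \<open>f(y) - f(x)\<close>, by monotonicity of \<open>f\<close>. One of them equals \<open>f(y) - f(x)\<close>, so their average
  \<open>f(y) - f(A)\<close> has modulus at least \<open>\<bar>f(y) - f(x)\<bar> / n\<close>. Comparing both sides with \<open>y - A\<close> and
  \<open>y - x\<close> through the bounds \<open>m \<le> \<bar>f'\<bar> \<le> M\<close> gives the factor \<open>m / (M n)\<close>.\<close>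

lemma quasi_arith_below_max:
  fixes f :: "real \<Rightarrow> real"
  assumes I: "is_interval I" and f: "f \<in> S_Lip I" and pq: "p \<le> q" and sub: "{p..q} \<subseteq> I"
  obtains c where "0 < c" "c \<le> 1"
    and "\<And>(v::real^'n::finite) y. v \<in> cube {p..q} \<Longrightarrow> (\<And>k. v $ k \<le> y) \<Longrightarrow>
      quasi_arith_mean I f v \<le> y - c * spread v"
proof -
  obtain f' m M L where m: "0 < m"
    and D: "\<And>x. x \<in> {p..q} \<Longrightarrow> (f has_real_derivative f' x) (at x within {p..q})"
    and b: "\<And>x. x \<in> {p..q} \<Longrightarrow> m \<le> \<bar>f' x\<bar> \<and> \<bar>f' x\<bar> \<le> M"
    using S_Lip_bounds_on_compact[OF f sub] by metis
  define n where "n = real CARD('n)"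
  have n: "n \<ge> 1"
    using zero_less_card_finite[where 'a='n] by (simp add: n_def Suc_le_eq)
  have mM: "m \<le> M" using b[of p] pq by auto
  then have M: "0 < M" using m by simp
  have M1: "M \<le> M * n" using M n by simp
  show ?thesis
  proof (rule that[of "m / (M * n)"])
    show "0 < m / (M * n)" using m M n by simp
    show "m / (M * n) \<le> 1" using order_trans[OF mM M1] M n by (subst divide_le_eq_1_pos) auto
    fix v :: "real^'n" and ub assume v: "v \<in> cube {p..q}" and ub: "\<And>k. v $ k \<le> ub"
    obtain i j where ext: "\<And>k. v $ i \<le> v $ k" "\<And>k. v $ k \<le> v $ j"
      and s: "spread v = v $ j - v $ i"
      using entries_extrema by blast
    define x y where "x = v $ i" and "y = v $ j"
    define A where "A = quasi_arith_mean I f v"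
    have vxy: "v $ k \<in> {x..y}" for k using ext by (simp add: x_def y_def)
    have xy: "x \<le> y" using vxy by force
    have J: "{x..y} \<subseteq> {p..q}" using v by (auto simp: cube_def x_def y_def intro: order_trans)
    have A: "A \<in> {x..y}" "f A = (\<Sum>i\<in>UNIV. f (v $ i)) / n"
      unfolding A_def n_def by (rule quasi_arith_mean_between[OF I f]; use sub J vxy in blast)+
    define E where "E = f y - f x"
    have sgn: "0 \<le> E * (f y - f z)" if "z \<in> {x..y}" for z
    proof (cases "x < z \<and> z < y")
      case True
      have "continuous_on {x..y} f" "inj_on f {x..y}"
        using S_Lip_continuous_on[OF f] S_Lip_inj_on[OF I f] J sub
        by (meson continuous_on_subset inj_on_subset subset_trans)+
      then have "f x < f z \<and> f z < f y \<or> f y < f z \<and> f z < f x"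
        using continuous_inj_imp_mono[of x z y f] True by blast
      then show ?thesis
        by (auto simp: E_def zero_le_mult_iff)
    next
      case False
      then have "z = x \<or> z = y" using that by auto
      then show ?thesis by (auto simp: E_def)
    qed
    \<comment> \<open>all terms of the sum being nonnegative, the one of the smallest entry bounds it below\<close>
    have "E * E = E * (f y - f (v $ i))"
      by (simp add: E_def x_def)
    also have "\<dots> \<le> (\<Sum>k\<in>UNIV. E * (f y - f (v $ k)))"
      by (rule member_le_sum) (use sgn vxy in auto)
    also have "\<dots> = E * (n * f y - n * f A)"
      using A(2) n by (simp add: sum_subtractf sum_distrib_left[symmetric] n_def)
    also have "\<dots> \<le> \<bar>E\<bar> * (n * \<bar>f y - f A\<bar>)"
      using n by (metis abs_ge_self abs_mult abs_of_nonneg order_trans right_diff_distrib zero_le_one)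
    finally have "\<bar>E\<bar> * \<bar>E\<bar> \<le> \<bar>E\<bar> * (n * \<bar>f y - f A\<bar>)"
      by simp
    then have E: "\<bar>E\<bar> \<le> n * \<bar>f y - f A\<bar>"
      using n by (cases "E = 0") (auto simp del: abs_mult_self_eq)
    have "m * (y - x) \<le> \<bar>E\<bar>"
      unfolding E_def using b xy J by (intro expanding_if_deriv_bounded_below[OF D]) auto
    also note E
    also have "\<bar>f y - f A\<bar> \<le> M * \<bar>y - A\<bar>"
      using field_differentiable_bound[of "{p..q}" f f' M y A] D b A J xy by auto
    then have "n * \<bar>f y - f A\<bar> \<le> n * (M * \<bar>y - A\<bar>)"
      using n by (intro mult_left_mono) auto
    also have "\<bar>y - A\<bar> = y - A" using A by simp
    finally have "m * (y - x) \<le> (M * n) * (y - A)"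
      by (simp add: mult_ac)
    then have "m / (M * n) * (y - x) \<le> y - A"
      using M n by (simp add: field_simps)
    then show "quasi_arith_mean I f v \<le> ub - m / (M * n) * spread v"
      using ub[of j] by (simp add: s A_def x_def y_def)
  qed
qed

section \<open>One step of the iteration\<close>

lemma quasi_arith_map_cube:
  fixes f :: "'n::finite \<Rightarrow> real \<Rightarrow> real"
  assumes "is_interval I" "\<And>i. f i \<in> S_Lip I" "{x..y} \<subseteq> I" "v \<in> cube {x..y}"
  shows "quasi_arith_map I f v \<in> cube {x..y}"
proof -
  have "v $ i \<in> {x..y}" for i
    using assms(4) by (simp add: cube_def)
  then have "quasi_arith_mean I (f i) v \<in> {x..y}" for i
    by (rule quasi_arith_mean_between(1)[OF assms(1) assms(2) assms(3)])
  then show ?thesis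
    by (simp add: cube_def quasi_arith_map_def)
qed

text \<open>All components are compared with the same arithmetic mean, which costs a factor two.\<close>

lemma spread_quasi_arith_map_quadratic:
  fixes f :: "'n::finite \<Rightarrow> real \<Rightarrow> real"
  assumes I: "is_interval I" and f: "\<And>i. f i \<in> S_Lip I" and sub: "{p..q} \<subseteq> I"
  obtains C where "\<And>v. v \<in> cube {p..q} \<Longrightarrow>
    spread (quasi_arith_map I f v) \<le> C * (spread v)\<^sup>2"
proof -
  have "\<exists>C. \<forall>v::real^'n. v \<in> cube {p..q} \<longrightarrow>
      \<bar>quasi_arith_mean I (f i) v - (\<Sum>i\<in>UNIV. v $ i) / real CARD('n)\<bar> \<le> C * (spread v)\<^sup>2" for i
    using quasi_arith_near_arithmetic[OF I f sub, of i] by metis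
  then obtain C where C: "\<And>i v. v \<in> cube {p..q} \<Longrightarrow>
      \<bar>quasi_arith_mean I (f i) v - (\<Sum>i\<in>UNIV. (v::real^'n) $ i) / real CARD('n)\<bar>
        \<le> C i * (spread v)\<^sup>2"
    by metis
  define B where "B = Max (range C)"
  show ?thesis
  proof (rule that[of "2 * B"])
    fix v :: "real^'n" assume v: "v \<in> cube {p..q}"
    have near: "\<bar>quasi_arith_mean I (f i) v - (\<Sum>i\<in>UNIV. v $ i) / real CARD('n)\<bar>
        \<le> B * (spread v)\<^sup>2" for i
      by (rule order_trans[OF C[OF v] mult_right_mono]) (auto simp: B_def)
    show "spread (quasi_arith_map I f v) \<le> 2 * B * (spread v)\<^sup>2"
    proof (rule spread_leI)
      fix i j
      show "quasi_arith_map I f v $ i - quasi_arith_map I f v $ j \<le> 2 * B * (spread v)\<^sup>2"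
        using near[of i] near[of j] by (simp add: quasi_arith_map_def abs_le_iff)
    qed
  qed
qed

text \<open>It is enough that the upper end of the range moves: the components stay above the smallest
  entry of \<open>v\<close> and stay below the largest one by a fixed fraction of \<open>\<delta>(v)\<close>.\<close>

lemma spread_quasi_arith_map_contracts:
  fixes f :: "'n::finite \<Rightarrow> real \<Rightarrow> real"
  assumes I: "is_interval I" and f: "\<And>i. f i \<in> S_Lip I" and pq: "p \<le> q" and sub: "{p..q} \<subseteq> I"
  obtains \<theta> where "0 \<le> \<theta>" "\<theta> < 1"
    and "\<And>v. v \<in> cube {p..q} \<Longrightarrow> spread (quasi_arith_map I f v) \<le> \<theta> * spread v"
proof -
  have "\<exists>c. 0 < c \<and> c \<le> 1 \<and> (\<forall>(v::real^'n) y. v \<in> cube {p..q} \<longrightarrow> (\<forall>k. v $ k \<le> y) \<longrightarrow>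
      quasi_arith_mean I (f i) v \<le> y - c * spread v)" for i
    using quasi_arith_below_max[OF I f pq sub, of i] by metis
  then obtain c where c: "\<And>i. 0 < c i" "\<And>i. c i \<le> 1"
    "\<And>i v y. v \<in> cube {p..q} \<Longrightarrow> (\<And>k. (v::real^'n) $ k \<le> y) \<Longrightarrow>
      quasi_arith_mean I (f i) v \<le> y - c i * spread v"
    by metis
  define b where "b = Min (range c)"
  have "b \<in> range c" unfolding b_def by (intro Min_in) auto
  then have b: "0 < b" "b \<le> 1" using c by auto
  have bc: "b \<le> c i" for i unfolding b_def by simp
  show ?thesis
  proof (rule that[of "1 - b"])
    fix v :: "real^'n" assume v: "v \<in> cube {p..q}"
    obtain i j where ext: "\<And>k. v $ i \<le> v $ k" "\<And>k. v $ k \<le> v $ j"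
      and s: "spread v = v $ j - v $ i"
      using entries_extrema by blast
    have "{v $ i..v $ j} \<subseteq> I"
      using v by (intro subset_trans[OF _ sub]) (auto simp: cube_def intro: order_trans)
    then have lower: "v $ i \<le> quasi_arith_map I f v $ l" for l
      using quasi_arith_map_cube[OF I f, of "v $ i" "v $ j" v] ext by (auto simp: cube_def)
    have upper: "quasi_arith_map I f v $ k \<le> v $ j - b * spread v" for k
    proof -
      have "quasi_arith_mean I (f k) v \<le> v $ j - c k * spread v"
        using c(3)[OF v ext(2)] .
      also have "\<dots> \<le> v $ j - b * spread v"
        using mult_right_mono[OF bc spread_nonneg] by simp
      finally show ?thesis by (simp add: quasi_arith_map_def)
    qed
    show "spread (quasi_arith_map I f v) \<le> (1 - b) * spread v"
    proof (rule spread_leI)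
      fix k l
      have "(1 - b) * spread v = (v $ j - b * spread v) - v $ i"
        by (simp add: left_diff_distrib s)
      then show "quasi_arith_map I f v $ k - quasi_arith_map I f v $ l \<le> (1 - b) * spread v"
        using upper[of k] lower[of l] by simp
    qed
  qed (use b in auto)
qed

section \<open>Quadratic convergence\<close>

theorem corollary3p3:
  fixes I :: "real set"
    and f :: "'n::finite \<Rightarrow> real \<Rightarrow> real"
    and a :: "real^'n"
  assumes "is_interval I"
    and "\<And>i. f i \<in> S_Lip I"
    and "a \<in> cube I"
  shows "degenerated I (quasi_arith_map I f) \<or>
         tends_to_zero_quadratically (\<lambda>k. spread ((quasi_arith_map I f ^^ Suc k) a))"
proof (rule disjI2)
  let ?F = "quasi_arith_map I f"
  obtain i j where ext: "\<And>k. a $ i \<le> a $ k" "\<And>k. a $ k \<le> a $ j"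
    by (metis entries_extrema)
  define p q where "p = a $ i" and "q = a $ j"
  have pq: "p \<le> q" using ext by (simp add: p_def q_def)
  have sub: "{p..q} \<subseteq> I"
    using assms(1,3) unfolding p_def q_def cube_def
    by (auto intro: mem_is_interval_1_I[of I "a $ i" "a $ j"])
  have inv: "(?F ^^ k) a \<in> cube {p..q}" for k
  proof (induction k)
    case 0
    then show ?case using ext by (simp add: cube_def p_def q_def)
  next
    case (Suc k)
    then show ?case using quasi_arith_map_cube[OF assms(1,2) sub] by simp
  qed
  define d where "d k = spread ((?F ^^ k) a)" for k
  obtain C where C: "\<And>v. v \<in> cube {p..q} \<Longrightarrow> spread (?F v) \<le> C * (spread v)\<^sup>2"
    using spread_quasi_arith_map_quadratic[where f=f, OF assms(1,2) sub] by blast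
  obtain \<theta> where \<theta>: "0 \<le> \<theta>" "\<theta> < 1"
    "\<And>v. v \<in> cube {p..q} \<Longrightarrow> spread (?F v) \<le> \<theta> * spread v"
    using spread_quasi_arith_map_contracts[where f=f, OF assms(1,2) pq sub] by blast
  have geometric: "d k \<le> \<theta> ^ k * d 0" for k
  proof (induction k)
    case (Suc k)
    have "d (Suc k) \<le> \<theta> * d k" using \<theta>(3)[OF inv[of k]] by (simp add: d_def)
    also have "\<dots> \<le> \<theta> * (\<theta> ^ k * d 0)" using Suc \<theta>(1) by (rule mult_left_mono)
    finally show ?case by simp
  qed simp
  have "(\<lambda>k. \<theta> ^ k * d 0) \<longlonglongrightarrow> 0"
    using \<theta> by (intro tendsto_mult_left_zero LIMSEQ_realpow_zero)
  moreover have "0 \<le> d k" for k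
    by (simp add: d_def spread_nonneg)
  ultimately have "d \<longlonglongrightarrow> 0"
    using tendsto_sandwich[of "\<lambda>_. 0" d sequentially "\<lambda>k. \<theta> ^ k * d 0" 0] geometric by simp
  then have "(\<lambda>k. d (Suc k)) \<longlonglongrightarrow> 0"
    by (rule LIMSEQ_Suc)
  moreover have "d (Suc (Suc k)) \<le> C * (d (Suc k))\<^sup>2" for k
    using C[OF inv[of "Suc k"]] by (simp add: d_def)
  ultimately have "tends_to_zero_quadratically (\<lambda>k. d (Suc k))"
    unfolding tends_to_zero_quadratically_def by (auto simp: d_def spread_nonneg)
  then show "tends_to_zero_quadratically (\<lambda>k. spread ((?F ^^ Suc k) a))"
    by (simp add: d_def)
qed

end
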